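(* Let $\mathbb{K}$ be a field and let $q\in\mathbb{K}$ be nonzero with $q^2\neq1$. For each $i\in\mathbb{Z}_4$ there exists a $\mathbb{K}$-algebra homomorphism from $U_q(L(\mathfrak{sl}_2))$ to $\boxtimes_q$ that sends $$x_1\mapsto x_{i,i+2},\quad y_1\mapsto x_{i+2,i+3},\quad z_1\mapsto x_{i+3,i},\quad x_0\mapsto x_{i+2,i},\quad y_0\mapsto x_{i,i+1},\quad z_0\mapsto x_{i+1,i+2},$$ where $x_j,y_j,z_j$ ($j\in\{0,1\}$) are the generators of $U_q(L(\mathfrak{sl}_2))$ in its equitable presentation.
   Context: Let $[n]_q=\frac{q^n-q^{-n}}{q-q^{-1}}$ and $\mathbb{Z}_4=\mathbb{Z}/4\mathbb{Z}$. The $q$-tetrahedron algebra $\boxtimes_q$ is the unital associative $\mathbb{K}$-algebra with generators $\{x_{ij}\mid i,j\in\mathbb{Z}_4,\ j-i=1\text{ or }j-i=2\}$ and relations: (i) for $i,j\in\mathbb{Z}_4$ with $j-i=2$, $x_{ij}x_{ji}=1$; (ii) for $h,i,j\in\mathbb{Z}_4$ such that $(i-h,j-i)$ is one of $(1,1),(1,2),(2,1)$, $\frac{q x_{hi}x_{ij}-q^{-1}x_{ij}x_{hi}}{q-q^{-1}}=1$; (iii) for $h,i,j,k\in\mathbb{Z}_4$ with $i-h=j-i=k-j=1$, $x_{hi}^3x_{jk}-[3]_q x_{hi}^2x_{jk}x_{hi}+[3]_q x_{hi}x_{jk}x_{hi}^2-x_{jk}x_{hi}^3=0$. The $U_q(\mathfrak{sl}_2)$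 loop algebra $U_q(L(\mathfrak{sl}_2))$ is the unital associative $\mathbb{K}$-algebra with generators $K_i,e_i^{\pm}$, $i\in\{0,1\}$, and relations $K_0K_1=K_1K_0=1$; $K_ie_i^{\pm}K_i^{-1}=q^{\pm2}e_i^{\pm}$; $K_ie_j^{\pm}K_i^{-1}=q^{\mp2}e_j^{\pm}$ ($i\ne j$); $[e_i^+,e_i^-]=\frac{K_i-K_i^{-1}}{q-q^{-1}}$; $[e_0^{\pm},e_1^{\mp}]=0$; $(e_i^{\pm})^3e_j^{\pm}-[3]_q(e_i^{\pm})^2e_j^{\pm}e_i^{\pm}+[3]_qe_i^{\pm}e_j^{\pm}(e_i^{\pm})^2-e_j^{\pm}(e_i^{\pm})^3=0$ ($i\neq j$). It is known to have the following equivalent (equitable) presentation: generators $x_i,y_i,z_i$, $i\in\{0,1\}$, and relations $x_0x_1=x_1x_0=1$; $\frac{qx_iy_i-q^{-1}y_ix_i}{q-q^{-1}}=1$; $\frac{qy_iz_i-q^{-1}z_iy_i}{q-q^{-1}}=1$; $\frac{qz_ix_i-q^{-1}x_iz_i}{q-q^{-1}}=1$; $\frac{qz_iy_j-q^{-1}y_jz_i}{q-q^{-1}}=1$ ($i\ne j$); $y_i^3y_j-[3]_qy_i^2y_jy_i+[3]_qy_iy_jy_i^2-y_jy_i^3=0$ ($i\neq j$); $z_i^3z_j-[3]_qz_i^2z_jz_i+[3]_qz_iz_jz_i^2-z_jz_i^3=0$ ($i\ne j$). An isomorphism from this presentation to the first is $x_i\mapsto K_i$, $y_i\mapsto K_i^{-1}+e_i^-$,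 $z_i\mapsto K_i^{-1}-K_i^{-1}e_i^+q(q-q^{-1})^2$. *)

theory Defs
  imports
    "HOL-Library.Poly_Mapping"
    "HOL-Library.Numeral_Type"
    "HOL-Algebra.Module"
    "HOL-Algebra.QuotRing"
    "HOL-Algebra.Algebraic_Closure_Type"
begin

section \<open>Unital associative algebras by generators and relations\<close>

text \<open>The free monoid on \<open>'x\<close>, written additively (but not commutative) because
  multiplication on \<^typ>\<open>'a \<Rightarrow>\<^sub>0 'b\<close> is convolution over an additive monoid.\<close>

datatype 'x word = Word (letters: "'x list")

instantiation word :: (type) monoid_add
begin
definition zero_word :: "'a word" where "0 = Word []"
definition plus_word :: "'a word \<Rightarrow> 'a word \<Rightarrow> 'a word"
  where "u + v = Word (letters u @ letters v)"
instance
  by standard (simp_all add: zero_word_def plus_word_def)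
end

type_synonym ('x, 'k) free_alg = "'x word \<Rightarrow>\<^sub>0 'k"

definition gen :: "'x \<Rightarrow> ('x, 'k::field) free_alg"
  where "gen x = Poly_Mapping.single (Word [x]) 1"

definition sc :: "'k::field \<Rightarrow> ('x, 'k) free_alg"
  where "sc c = Poly_Mapping.single 0 c"

abbreviation free_ring :: "('x, 'k::field) free_alg ring"
  where "free_ring \<equiv> ring_of_type_algebra"

text \<open>A pair \<open>(l, r)\<close> in a set of relations stands for the relation \<open>l = r\<close>.\<close>

definition rel_ideal ::
  "(('x, 'k::field) free_alg \<times> ('x, 'k) free_alg) set \<Rightarrow> ('x, 'k) free_alg set"
  where "rel_ideal R = genideal free_ring {l - r | l r. (l, r) \<in> R}"

definition cls ::
  "(('x, 'k::field) free_alg \<times> ('x, 'k) free_alg) set \<Rightarrow> ('x, 'k) free_alg \<Rightarrow> ('x, 'k) free_alg set"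
  where "cls R a = rel_ideal R +>\<^bsub>free_ring\<^esub> a"

definition presented_algebra ::
  "(('x, 'k::field) free_alg \<times> ('x, 'k) free_alg) set \<Rightarrow> ('k, ('x, 'k) free_alg set) module"
  where "presented_algebra R =
    (let Q = free_ring Quot rel_ideal R in
      ring.extend Q (module.fields (\<lambda>c Y. cls R (sc c) \<otimes>\<^bsub>Q\<^esub> Y)))"

text \<open>The scalars are all of \<open>'k\<close>. The locale \<open>algebra\<close> of HOL-Algebra covers commutative
  algebras only.\<close>

definition algebra_hom :: "('k::field, 'a) module \<Rightarrow> ('k, 'b) module \<Rightarrow> ('a \<Rightarrow> 'b) set"
  where "algebra_hom A B =
    {f \<in> ring_hom A B. \<forall>c. \<forall>a \<in> carrier A. f (c \<odot>\<^bsub>A\<^esub> a) = c \<odot>\<^bsub>B\<^esub> f a}"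

section \<open>Expressions occurring in the relations\<close>

definition qint :: "'k::field \<Rightarrow> nat \<Rightarrow> 'k"
  where "qint q n = (q ^ n - inverse q ^ n) / (q - inverse q)"

definition q_weyl ::
  "'k::field \<Rightarrow> ('x, 'k) free_alg \<Rightarrow> ('x, 'k) free_alg \<Rightarrow> ('x, 'k) free_alg"
  where "q_weyl q a b = sc (1 / (q - inverse q)) * (sc q * a * b - sc (inverse q) * b * a)"

definition q_serre ::
  "'k::field \<Rightarrow> ('x, 'k) free_alg \<Rightarrow> ('x, 'k) free_alg \<Rightarrow> ('x, 'k) free_alg"
  where "q_serre q a b =
    a ^ 3 * b - sc (qint q 3) * a ^ 2 * b * a + sc (qint q 3) * a * b * a ^ 2 - b * a ^ 3"

section \<open>The q-tetrahedron algebra\<close>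

text \<open>The numeral type \<^typ>\<open>4\<close> is the ring of integers modulo 4.\<close>

typedef tet_gen = "{(i, j). j - i = 1 \<or> j - i = 2} :: (4 \<times> 4) set"
  by (rule exI[of _ "(0, 1)"]) simp

text \<open>\<open>tet i j\<close> is meaningful only if \<open>j - i\<close> is 1 or 2; it is used only for such \<open>i, j\<close>.\<close>

definition tet :: "4 \<Rightarrow> 4 \<Rightarrow> (tet_gen, 'k::field) free_alg"
  where "tet i j = gen (Abs_tet_gen (i, j))"

definition tet_rels ::
  "'k::field \<Rightarrow> ((tet_gen, 'k) free_alg \<times> (tet_gen, 'k) free_alg) set"
  where "tet_rels q =
    {(tet i j * tet j i, 1) | i j. j - i = 2}
    \<union> {(q_weyl q (tet h i) (tet i j), 1) | h i j. (i - h, j - i) \<in> {(1, 1), (1, 2), (2, 1)}}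
    \<union> {(q_serre q (tet h i) (tet j k), 0) | h i j k. i - h = 1 \<and> j - i = 1 \<and> k - j = 1}"

definition tet_algebra :: "'k::field \<Rightarrow> ('k, (tet_gen, 'k) free_alg set) module"
  where "tet_algebra q = presented_algebra (tet_rels q)"

definition tet_x :: "'k::field \<Rightarrow> 4 \<Rightarrow> 4 \<Rightarrow> (tet_gen, 'k) free_alg set"
  where "tet_x q i j = cls (tet_rels q) (tet i j)"

section \<open>The loop algebra of quantum sl2\<close>

text \<open>The index set is \<open>{0, 1}\<close>, represented by the numeral type \<^typ>\<open>2\<close>.\<close>

datatype loop_gen = GK 2 | GEplus 2 | GEminus 2

definition lK :: "2 \<Rightarrow> (loop_gen, 'k::field) free_alg" where "lK i = gen (GK i)"
definition eplus :: "2 \<Rightarrow> (loop_gen, 'k::field) free_alg" where "eplus i = gen (GEplus i)"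
definition eminus :: "2 \<Rightarrow> (loop_gen, 'k::field) free_alg" where "eminus i = gen (GEminus i)"

text \<open>Since \<open>K\<^sub>0 K\<^sub>1 = K\<^sub>1 K\<^sub>0 = 1\<close> in the algebra, the inverse of \<open>K\<^sub>i\<close> is the other \<open>K\<close>.\<close>

definition lKinv :: "2 \<Rightarrow> (loop_gen, 'k::field) free_alg" where "lKinv i = lK (1 - i)"

definition loop_rels ::
  "'k::field \<Rightarrow> ((loop_gen, 'k) free_alg \<times> (loop_gen, 'k) free_alg) set"
  where "loop_rels q =
    {(lK 0 * lK 1, 1), (lK 1 * lK 0, 1)}
    \<union> {(lK i * eplus i * lKinv i, sc (q ^ 2) * eplus i) | i. True}
    \<union> {(lK i * eminus i * lKinv i, sc (inverse q ^ 2) * eminus i) | i. True}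
    \<union> {(lK i * eplus j * lKinv i, sc (inverse q ^ 2) * eplus j) | i j. i \<noteq> j}
    \<union> {(lK i * eminus j * lKinv i, sc (q ^ 2) * eminus j) | i j. i \<noteq> j}
    \<union> {(eplus i * eminus i - eminus i * eplus i,
         sc (1 / (q - inverse q)) * (lK i - lKinv i)) | i. True}
    \<union> {(eplus 0 * eminus 1 - eminus 1 * eplus 0, 0), (eminus 0 * eplus 1 - eplus 1 * eminus 0, 0)}
    \<union> {(q_serre q (eplus i) (eplus j), 0) | i j. i \<noteq> j}
    \<union> {(q_serre q (eminus i) (eminus j), 0) | i j. i \<noteq> j}"

definition loop_algebra :: "'k::field \<Rightarrow> ('k, (loop_gen, 'k) free_alg set) module"
  where "loop_algebra q = presented_algebra (loop_rels q)"

text \<open>The equitable generators, as the elements of the algebra to which the isomorphism from the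
  equitable presentation sends them:
  \<open>x\<^sub>i = K\<^sub>i\<close>, \<open>y\<^sub>i = K\<^sub>i\<^sup>-\<^sup>1 + e\<^sub>i\<^sup>-\<close>, \<open>z\<^sub>i = K\<^sub>i\<^sup>-\<^sup>1 - K\<^sub>i\<^sup>-\<^sup>1 e\<^sub>i\<^sup>+ q (q - q\<^sup>-\<^sup>1)\<^sup>2\<close>.\<close>

definition loop_x :: "'k::field \<Rightarrow> 2 \<Rightarrow> (loop_gen, 'k) free_alg set"
  where "loop_x q i = cls (loop_rels q) (lK i)"

definition loop_y :: "'k::field \<Rightarrow> 2 \<Rightarrow> (loop_gen, 'k) free_alg set"
  where "loop_y q i = cls (loop_rels q) (lKinv i + eminus i)"

definition loop_z :: "'k::field \<Rightarrow> 2 \<Rightarrow> (loop_gen, 'k) free_alg set"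
  where "loop_z q i =
    cls (loop_rels q) (lKinv i - lKinv i * eplus i * sc (q * (q - inverse q) ^ 2))"

end

theory Submission
  imports Defs
begin

text \<open>The images of the six equitable generators are prescribed, so the images of the
  Chevalley generators are forced: solving \<open>y\<^sub>i = K\<^sub>i\<^sup>-\<^sup>1 + e\<^sub>i\<^sup>-\<close> and
  \<open>z\<^sub>i = K\<^sub>i\<^sup>-\<^sup>1 - K\<^sub>i\<^sup>-\<^sup>1 e\<^sub>i\<^sup>+ q (q - q\<^sup>-\<^sup>1)\<^sup>2\<close> gives \<open>K\<^sub>i \<mapsto> x\<^sub>i\<close>, \<open>e\<^sub>i\<^sup>- \<mapsto> y\<^sub>i - x\<^sub>i\<^sup>-\<^sup>1\<close> and
  \<open>e\<^sub>i\<^sup>+ \<mapsto> (1 - x\<^sub>i z\<^sub>i) / (q (q - q\<^sup>-\<^sup>1)\<^sup>2)\<close>. Since the loop algebra is given by generators and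
  relations, what has to be checked is that these images satisfy its defining relations. The
  relations between \<open>x\<^sub>i, y\<^sub>i, z\<^sub>i\<close> that this needs are the equitable ones, and for the chosen six
  elements each of them is one of the defining relations of the q-tetrahedron algebra.

  Everything is computed in the free algebra modulo the two-sided ideal of relations, with
  \<open>p = q\<^sup>2\<close> and the skew commutator \<open>[a, u]\<^sub>c = a u - c u a\<close>. All but the Serre relations are
  membership statements for which explicit combinations of the given relations are written down.

  The Serre relations rest on the factorization of the cubic Serre element as
  \<open>[a, [a, [a, b]\<^bsub>1/p\<^esub>]\<^sub>1]\<^sub>p\<close>. The operators \<open>[a, -]\<^sub>c\<close> are additive in \<open>a\<close>, and if \<open>[k, u]\<^sub>c = 0\<close>, that is, if
  \<open>u\<close> has weight \<open>c\<close> under \<open>k\<close>, then replacing \<open>a\<close> by \<open>a + k\<close> does not change \<open>[a, u]\<^sub>c\<close>. If \<open>a\<close> has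
  weight \<open>p\<close> and \<open>b\<close> weight \<open>1/p\<close>, then the three successive brackets meet weights \<open>1/p\<close>, \<open>1\<close> and \<open>p\<close>,
  exactly their own parameters, so all three are unaffected (\<open>serre_shift\<close>); the term \<open>k\<^sup>-\<^sup>1\<close> that is
  added to \<open>b\<close> is killed by the same mechanism (\<open>serre_shift_unit\<close>). This turns the Serre relation
  for \<open>y\<^sub>i, y\<^sub>j\<close> into the one for \<open>e\<^sub>i\<^sup>-, e\<^sub>j\<^sup>-\<close>, and the one for \<open>z\<^sub>i, z\<^sub>j\<close> into one for \<open>z\<^sub>i - x\<^sub>i\<^sup>-\<^sup>1\<close> and
  \<open>z\<^sub>j - x\<^sub>j\<^sup>-\<^sup>1\<close>. As \<open>e\<^sub>i\<^sup>+\<close> is a multiple of \<open>(z\<^sub>i - x\<^sub>i\<^sup>-\<^sup>1) x\<^sub>i\<close>, it remains to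
  move the factors \<open>x\<^sub>i\<close>, \<open>x\<^sub>j\<close> to the right: in every word of the Serre element the powers of \<open>p\<close> that
  this produces cancel (\<open>serre_twist\<close>), which settles \<open>e\<^sub>i\<^sup>+, e\<^sub>j\<^sup>+\<close>.\<close>

section \<open>Skew commutators modulo an ideal\<close>

locale algebra_ideal = vector_space scale
  for scale :: "'k::field \<Rightarrow> 'a::ring_1 \<Rightarrow> 'a" (infixr \<open>*s\<close> 75) +
  fixes I :: "'a set"
  assumes mult_scale_left [simp]: "(c *s a) * b = c *s (a * b)"
    and mult_scale_right [simp]: "a * (c *s b) = c *s (a * b)"
    and zero_mem [simp]: "0 \<in> I"
    and add_mem: "a \<in> I \<Longrightarrow> b \<in> I \<Longrightarrow> a + b \<in> I"
    and mult_left_mem: "b \<in> I \<Longrightarrow> a * b \<in> I"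
    and mult_right_mem: "a \<in> I \<Longrightarrow> a * b \<in> I"
begin

lemma scale_mem: "a \<in> I \<Longrightarrow> c *s a \<in> I"
  using mult_left_mem[of a "c *s 1"] by simp

lemma uminus_mem: "a \<in> I \<Longrightarrow> - a \<in> I"
  using mult_left_mem[of a "- 1"] by simp

lemma diff_mem: "a \<in> I \<Longrightarrow> b \<in> I \<Longrightarrow> a - b \<in> I"
  using add_mem[of a "- b"] uminus_mem[of b] by simp

lemmas mem_intros = add_mem diff_mem uminus_mem scale_mem mult_left_mem mult_right_mem

text \<open>The standard way to prove a congruence below: an identity of the free algebra exhibits the
  element as a combination of elements already known to lie in the ideal.\<close>

lemma eq_mem: "a = b \<Longrightarrow> b \<in> I \<Longrightarrow> a \<in> I"
  by simp

lemma mem_cong: "a - b \<in> I \<Longrightarrow> b \<in> I \<Longrightarrow> a \<in> I"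
  using add_mem[of "a - b" b] by simp

definition skew_comm :: "'k \<Rightarrow> 'a \<Rightarrow> 'a \<Rightarrow> 'a"
  where "skew_comm c a u = a * u - c *s (u * a)"

text \<open>Expanded in \<open>serre_expand\<close>: for \<open>p = q\<^sup>2\<close> this is the usual cubic q-Serre element, because
  \<open>1 - [3]\<^sub>q t + [3]\<^sub>q t\<^sup>2 - t\<^sup>3 = (1 - t) (1 - p t) (1 - t/p)\<close>.\<close>

definition serre :: "'k \<Rightarrow> 'a \<Rightarrow> 'a \<Rightarrow> 'a"
  where "serre p a b = skew_comm p a (skew_comm 1 a (skew_comm (1 / p) a b))"

lemma skew_comm_scale: "skew_comm c (r *s a) (s *s u) = (r * s) *s skew_comm c a u"
  by (simp add: skew_comm_def scale_right_diff_distrib algebra_simps)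

lemma skew_comm_mult: "skew_comm (c * d) k (u * v) = skew_comm c k u * v + c *s (u * skew_comm d k v)"
  by (simp add: skew_comm_def algebra_simps)

text \<open>Weights under \<open>k\<close> multiply, so a skew commutator of eigenvectors is an eigenvector.\<close>

lemma skew_comm_weight:
  assumes "skew_comm c k a \<in> I" "skew_comm d k u \<in> I"
  shows "skew_comm (c * d) k (skew_comm e a u) \<in> I"
proof -
  have "skew_comm (c * d) k (skew_comm e a u) =
      skew_comm (c * d) k (a * u) - e *s skew_comm (d * c) k (u * a)"
    by (simp add: skew_comm_def algebra_simps)
  then show ?thesis
    by (rule eq_mem) (unfold skew_comm_mult, blast intro: mem_intros assms)
qed

lemma skew_comm_cong:
  assumes "a - a' \<in> I" "u - u' \<in> I"
  shows "skew_comm c a u - skew_comm c a' u' \<in> I"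
proof -
  have "skew_comm c a u - skew_comm c a' u' =
      (a - a') * u + a' * (u - u') - c *s ((u - u') * a + u' * (a - a'))"
    by (simp add: skew_comm_def algebra_simps)
  then show ?thesis
    by (rule eq_mem) (blast intro: mem_intros assms)
qed

lemma skew_comm_mem: "u \<in> I \<Longrightarrow> skew_comm c a u \<in> I"
  by (simp add: skew_comm_def mem_intros)

lemma skew_comm_add_left: "skew_comm c (a + k) u = skew_comm c a u + skew_comm c k u"
  by (simp add: skew_comm_def algebra_simps)

lemma skew_comm_commute: "skew_comm c a (skew_comm d a u) = skew_comm d a (skew_comm c a u)"
  by (simp add: skew_comm_def algebra_simps)

lemma skew_comm_inverse:
  assumes "k * k' - 1 \<in> I" "k' * k - 1 \<in> I" "skew_comm c k u \<in> I" "c \<noteq> 0"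
  shows "skew_comm (1 / c) k' u \<in> I"
proof -
  have "skew_comm (1 / c) k' u = - (1 / c) *s (k' * skew_comm c k u * k')
      + (1 / c) *s ((k' * k - 1) * (u * k')) - (k' * u) * (k * k' - 1)"
    using assms(4) by (simp add: skew_comm_def algebra_simps)
  then show ?thesis
    by (rule eq_mem) (blast intro: mem_intros assms)
qed

lemma skew_comm_unit:
  assumes "k * k' - 1 \<in> I" "k' * k - 1 \<in> I"
  shows "skew_comm 1 k k' \<in> I"
proof -
  have "skew_comm 1 k k' = (k * k' - 1) - (k' * k - 1)" by (simp add: skew_comm_def)
  then show ?thesis by (rule eq_mem) (blast intro: mem_intros assms)
qed

lemma conjugate_mem:
  assumes "k * k' - 1 \<in> I" "skew_comm c k u \<in> I"
  shows "k * u * k' - c *s u \<in> I"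
proof -
  have "k * u * k' - c *s u = skew_comm c k u * k' + c *s (u * (k * k' - 1))"
    by (simp add: skew_comm_def algebra_simps)
  then show ?thesis
    by (rule eq_mem) (blast intro: mem_intros assms)
qed

section \<open>The cubic q-Serre element\<close>

lemma serre_expand:
  assumes "p \<noteq> 0"
  shows "serre p a b = a * a * a * b - (p + 1 + 1 / p) *s (a * a * b * a)
    + (p + 1 + 1 / p) *s (a * b * a * a) - b * a * a * a"
  using assms by (simp add: serre_def skew_comm_def algebra_simps)

lemma serre_add_right: "serre p a (b + b') = serre p a b + serre p a b'"
  by (simp add: serre_def skew_comm_def algebra_simps)

lemma serre_inverse: "p \<noteq> 0 \<Longrightarrow> serre (1 / p) a b = serre p a b"
  by (simp add: serre_expand algebra_simps)

lemma serre_cong: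
  assumes "a - a' \<in> I" "b - b' \<in> I"
  shows "serre p a b - serre p a' b' \<in> I"
  unfolding serre_def by (intro skew_comm_cong assms)

lemma serre_scale: "serre p (r *s a) (s *s b) = (r ^ 3 * s) *s serre p a b"
  by (simp add: serre_def skew_comm_scale power3_eq_cube mult.assoc)

lemma skew_comm_shift:
  "skew_comm c k u \<in> I \<Longrightarrow> skew_comm c (a + k) u - skew_comm c a u \<in> I"
  by (simp add: skew_comm_add_left)

text \<open>The weights of \<open>b\<close> and of its first two brackets with \<open>a\<close> are \<open>1/p\<close>, \<open>1\<close> and \<open>p\<close>. They agree with the
  parameters of the three brackets that form the Serre element, so \<open>k\<close> never contributes.\<close>

lemma serre_shift:
  assumes "p \<noteq> 0" "skew_comm p k a \<in> I" "skew_comm (1 / p) k b \<in> I"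
  shows "serre p (a + k) b - serre p a b \<in> I"
proof -
  define u where "u = skew_comm (1 / p) a b"
  define v where "v = skew_comm 1 a u"
  have ku: "skew_comm 1 k u \<in> I"
    using skew_comm_weight[OF assms(2,3), of "1 / p"] assms(1) by (simp add: u_def)
  have kv: "skew_comm p k v \<in> I"
    using skew_comm_weight[OF assms(2) ku, of 1] by (simp add: v_def)
  have "skew_comm (1 / p) (a + k) b - u \<in> I"
    unfolding u_def by (rule skew_comm_shift) fact
  then have "skew_comm 1 (a + k) (skew_comm (1 / p) (a + k) b) - skew_comm 1 (a + k) u \<in> I"
    by (intro skew_comm_cong) simp_all
  from add_mem[OF this skew_comm_shift[OF ku, of a]]
  have "skew_comm 1 (a + k) (skew_comm (1 / p) (a + k) b) - v \<in> I"
    by (simp add: v_def)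
  then have "serre p (a + k) b - skew_comm p (a + k) v \<in> I"
    unfolding serre_def by (intro skew_comm_cong) simp_all
  from add_mem[OF this skew_comm_shift[OF kv, of a]]
  show ?thesis by (simp add: serre_def u_def v_def)
qed

text \<open>Here \<open>k'\<close> is inverse to \<open>k\<close>. The bracket with parameter \<open>1\<close> sends \<open>k'\<close> to a multiple of \<open>a k'\<close>, of
  weight \<open>p\<close>, and the bracket with parameter \<open>p\<close> annihilates that element. The three brackets commute, so
  these two may be applied first.\<close>

lemma serre_shift_unit:
  assumes "p \<noteq> 0" "k * k' - 1 \<in> I" "k' * k - 1 \<in> I" "skew_comm p k a \<in> I"
  shows "serre p (a + k) k' \<in> I"
proof -
  define u where "u = (1 - 1 / p) *s (a * k')"
  have kk': "skew_comm 1 k k' \<in> I"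
    using skew_comm_unit[OF assms(2,3)] .
  have k'a: "skew_comm (1 / p) k' a \<in> I"
    using skew_comm_inverse[OF assms(2-4,1)] .
  have "skew_comm 1 (a + k) k' - u = skew_comm 1 k k' - skew_comm (1 / p) k' a"
    by (simp add: u_def skew_comm_def algebra_simps)
  then have step1: "skew_comm 1 (a + k) k' - u \<in> I"
    by (rule eq_mem) (blast intro: mem_intros kk' k'a)
  have "skew_comm p (a + k) u = (1 - 1 / p) *s (skew_comm (p * 1) k (a * k')
      - p *s (a * skew_comm (1 / p) k' a))"
    using assms(1) by (simp add: u_def skew_comm_def algebra_simps)
  then have step2: "skew_comm p (a + k) u \<in> I"
    by (rule eq_mem) (unfold skew_comm_mult, blast intro: mem_intros assms(4) kk' k'a)
  have "skew_comm p (a + k) (skew_comm 1 (a + k) k') \<in> I"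
    by (rule mem_cong[OF skew_comm_cong step2]) (use step1 in simp_all)
  moreover have "serre p (a + k) k' =
      skew_comm (1 / p) (a + k) (skew_comm p (a + k) (skew_comm 1 (a + k) k'))"
    unfolding serre_def by (simp only: skew_comm_commute[of "1 / p"])
  ultimately show ?thesis
    using skew_comm_mem by simp
qed

lemma serre_remove_units:
  assumes "p \<noteq> 0" "k * k' - 1 \<in> I" "k' * k - 1 \<in> I"
    and "skew_comm p k a \<in> I" "skew_comm (1 / p) k b \<in> I"
    and "serre p (a + k) (b + k') \<in> I"
  shows "serre p a b \<in> I"
proof -
  have "serre p a b = serre p (a + k) (b + k') - serre p (a + k) k'
      - (serre p (a + k) b - serre p a b)"
    by (simp add: serre_add_right)
  then show ?thesis
    by (rule eq_mem) (blast intro: mem_intros assms(6) serre_shift_unit[OF assms(1-4)] serre_shift[OF assms(1,4,5)])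
qed

text \<open>Moving \<open>k'\<close> past \<open>u\<close> in the first term of the bracket and \<open>v\<close> past \<open>g\<close> in the second costs the
  same scalar \<open>s\<close>, which therefore factors out.\<close>

lemma skew_comm_twist:
  assumes "skew_comm s k' u \<in> I" "skew_comm s v g \<in> I" "skew_comm 1 v k' \<in> I"
  shows "skew_comm c (g * k') (u * v) - s *s (skew_comm c g u * (k' * v)) \<in> I"
proof -
  have "skew_comm c (g * k') (u * v) - s *s (skew_comm c g u * (k' * v)) =
      g * skew_comm s k' u * v - c *s (u * skew_comm s v g * k')
      - (c * s) *s ((u * g) * skew_comm 1 v k')"
    by (simp add: skew_comm_def algebra_simps)
  then show ?thesis
    by (rule eq_mem) (blast intro: mem_intros assms)
qed

text \<open>Three applications of \<open>skew_comm_twist\<close>, with the unit attached to the second argument being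
  \<open>k\<close>, \<open>1\<close> and \<open>k'\<close> in turn. The scalars collected are \<open>p\<close>, \<open>1\<close> and \<open>1/p\<close>.\<close>

lemma serre_twist:
  assumes "p \<noteq> 0" "k * k' - 1 \<in> I" "k' * k - 1 \<in> I"
    and "skew_comm p k g \<in> I" "skew_comm (1 / p) k h \<in> I"
    and "serre p g h \<in> I"
  shows "serre p (g * k') (h * k) \<in> I"
proof -
  define u where "u = skew_comm (1 / p) g h"
  define v where "v = skew_comm 1 g u"
  have kk': "skew_comm 1 k k' \<in> I"
    using skew_comm_unit[OF assms(2,3)] .
  have k'g: "skew_comm (1 / p) k' g \<in> I"
    using skew_comm_inverse[OF assms(2-4,1)] .
  have k'h: "skew_comm p k' h \<in> I"
    using skew_comm_inverse[OF assms(2,3,5)] assms(1) by simp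
  have k'u: "skew_comm 1 k' u \<in> I"
    using skew_comm_weight[OF k'g k'h, of "1 / p"] assms(1) by (simp add: u_def)
  have k'v: "skew_comm (1 / p) k' v \<in> I"
    using skew_comm_weight[OF k'g k'u, of 1] by (simp add: v_def)
  let ?D = "\<lambda>c. skew_comm c (g * k')"
  have "?D (1 / p) (h * k) - p *s (u * (k' * k)) \<in> I"
    using skew_comm_twist[OF k'h assms(4) kk', of "1 / p"] by (simp add: u_def)
  moreover have "p *s (u * (k' * k)) - p *s u = p *s (u * (k' * k - 1))"
    by (simp add: algebra_simps)
  then have "p *s (u * (k' * k)) - p *s u \<in> I"
    by (rule eq_mem) (blast intro: mem_intros assms(3))
  ultimately have "?D (1 / p) (h * k) - p *s u \<in> I"
    using add_mem by fastforce
  then have "?D 1 (?D (1 / p) (h * k)) - ?D 1 (p *s u) \<in> I"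
    by (intro skew_comm_cong) simp_all
  moreover have "?D 1 (u * 1) - 1 *s (skew_comm 1 g u * (k' * 1)) \<in> I"
    by (rule skew_comm_twist[OF k'u]) (simp_all add: skew_comm_def)
  then have "p *s (?D 1 u - v * k') \<in> I"
    by (intro scale_mem) (simp add: v_def)
  then have "?D 1 (p *s u) - p *s (v * k') \<in> I"
    using skew_comm_scale[of 1 1 "g * k'" p u] by (simp add: scale_right_diff_distrib)
  ultimately have "?D 1 (?D (1 / p) (h * k)) - p *s (v * k') \<in> I"
    using add_mem by fastforce
  then have "serre p (g * k') (h * k) - ?D p (p *s (v * k')) \<in> I"
    unfolding serre_def by (intro skew_comm_cong) simp_all
  moreover have "?D p (v * k') - (1 / p) *s (skew_comm p g v * (k' * k')) \<in> I"
    by (rule skew_comm_twist[OF k'v k'g]) (simp add: skew_comm_def)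
  then have "?D p (v * k') \<in> I"
    by (rule mem_cong) (use assms(6) in \<open>simp add: serre_def u_def v_def mem_intros\<close>)
  then have "?D p (p *s (v * k')) \<in> I"
    using skew_comm_scale[of p 1 "g * k'" p "v * k'"] by (simp add: mem_intros)
  ultimately show ?thesis
    by (rule mem_cong)
qed

section \<open>Chevalley generators from equitable generators\<close>

text \<open>In the lemmas of this section \<open>x'\<close> stands for an inverse of \<open>x\<close> modulo the ideal, and the hypothesis
  \<open>[a, b]\<^bsub>1/p\<^esub> \<equiv> 1 - 1/p\<close> is the q-Weyl relation between \<open>a\<close> and \<open>b\<close>. The element \<open>r (1 - x z)\<close> becomes the
  raising generator for a suitable scalar \<open>r\<close>, and \<open>y - x'\<close> the lowering one. Up to a scalar and the
  unit \<open>x\<close>, the raising generator is the difference \<open>z - x'\<close>, to which the shift lemmas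
  apply.\<close>

lemma raising_cong:
  assumes "x * x' - 1 \<in> I"
  shows "r *s (1 - x * z) - (- r) *s (x * (z - x')) \<in> I"
proof -
  have "r *s (1 - x * z) - (- r) *s (x * (z - x')) = (- r) *s (x * x' - 1)"
    by (simp add: algebra_simps)
  then show ?thesis by (rule eq_mem) (blast intro: mem_intros assms)
qed

lemma lowering_skew_comm:
  assumes "x * x' - 1 \<in> I" "x' * x - 1 \<in> I"
    and "skew_comm (1 / p) x y - (1 - 1 / p) *s 1 \<in> I"
  shows "skew_comm (1 / p) x (y - x') \<in> I"
proof -
  have "skew_comm (1 / p) x (y - x') = (skew_comm (1 / p) x y - (1 - 1 / p) *s 1)
      - (x * x' - 1) + (1 / p) *s (x' * x - 1)"
    by (simp add: skew_comm_def algebra_simps)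
  then show ?thesis by (rule eq_mem) (blast intro: mem_intros assms)
qed

lemma shifted_raising_skew_comm:
  assumes "p \<noteq> 0" "x * x' - 1 \<in> I" "x' * x - 1 \<in> I"
    and "skew_comm (1 / p) z x - (1 - 1 / p) *s 1 \<in> I"
  shows "skew_comm p x (z - x') \<in> I"
proof -
  have "skew_comm p x (z - x') = - p *s (skew_comm (1 / p) z x - (1 - 1 / p) *s 1)
      - (x * x' - 1) + p *s (x' * x - 1)"
    using assms(1) by (simp add: skew_comm_def algebra_simps)
  then show ?thesis by (rule eq_mem) (blast intro: mem_intros assms)
qed

lemma raising_skew_comm:
  assumes "p \<noteq> 0" "skew_comm (1 / p) z x - (1 - 1 / p) *s 1 \<in> I"
  shows "skew_comm p x (r *s (1 - x * z)) \<in> I"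
proof -
  have "skew_comm p x (r *s (1 - x * z)) =
      (r * p) *s (x * (skew_comm (1 / p) z x - (1 - 1 / p) *s 1))"
    using assms(1) by (simp add: skew_comm_def algebra_simps)
  then show ?thesis by (rule eq_mem) (blast intro: mem_intros assms)
qed

text \<open>The combination below records the reduction of \<open>x z y\<close> and \<open>y x z\<close> to a common normal form:
  each q-Weyl relation is used once to exchange two neighbouring letters.\<close>

lemma raising_lowering_comm:
  fixes r :: 'k
  assumes "p \<noteq> 0" "x * x' - 1 \<in> I" "x' * x - 1 \<in> I"
    and "skew_comm (1 / p) x y - (1 - 1 / p) *s 1 \<in> I"
    and "skew_comm (1 / p) y z - (1 - 1 / p) *s 1 \<in> I"
    and "skew_comm (1 / p) z x - (1 - 1 / p) *s 1 \<in> I"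
  defines "e \<equiv> r *s (1 - x * z)"
  shows "e * (y - x') - (y - x') * e - (r * (p - 1)) *s (x - x') \<in> I"
proof -
  let ?w = "\<lambda>a b. skew_comm (1 / p) a b - (1 - 1 / p) *s 1"
  have "e * (y - x') - (y - x') * e - (r * (p - 1)) *s (x - x') =
      r *s (- p *s (?w x y * z) + p *s (x * ?w y z) - p *s (?w z x * x')
        + p *s (z * (x * x' - 1)) - (x' * x - 1) * z)"
    using assms(1) by (simp add: e_def skew_comm_def algebra_simps)
  then show ?thesis by (rule eq_mem) (blast intro: mem_intros assms(2-6))
qed

text \<open>Here \<open>w\<close> is the generator \<open>y\<close> of the other index, whose lowering generator is \<open>w - x\<close>, since
  \<open>x\<close> is inverse to \<open>x'\<close>.\<close>

lemma raising_other_lowering_comm: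
  fixes r :: 'k
  assumes "p \<noteq> 0" "x * x' - 1 \<in> I" "x' * x - 1 \<in> I"
    and "skew_comm (1 / p) x' w - (1 - 1 / p) *s 1 \<in> I"
    and "skew_comm (1 / p) z w - (1 - 1 / p) *s 1 \<in> I"
    and "skew_comm (1 / p) z x - (1 - 1 / p) *s 1 \<in> I"
  defines "e \<equiv> r *s (1 - x * z)"
  shows "e * (w - x) - (w - x) * e \<in> I"
proof -
  let ?w = "\<lambda>a b. skew_comm (1 / p) a b - (1 - 1 / p) *s 1"
  have "e * (w - x) - (w - x) * e =
      r *s (- (x * ?w z w) + x * ?w x' w * (x * z) - (x * x' - 1) * (w * x * z)
        + (1 / p) *s (x * w * (x' * x - 1) * z) + x * ?w z x)"
    using assms(1) by (simp add: e_def skew_comm_def algebra_simps)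
  then show ?thesis by (rule eq_mem) (blast intro: mem_intros assms(2-6))
qed

lemma lowering_serre:
  assumes "p \<noteq> 0" "x * x' - 1 \<in> I" "x' * x - 1 \<in> I"
    and "skew_comm (1 / p) x y - (1 - 1 / p) *s 1 \<in> I"
    and "skew_comm (1 / p) x' y' - (1 - 1 / p) *s 1 \<in> I"
    and "serre p y y' \<in> I"
  shows "serre p (y - x') (y' - x) \<in> I"
proof (rule serre_remove_units[of _ x' x])
  show "skew_comm p x' (y - x') \<in> I"
    using skew_comm_inverse[OF assms(2,3) lowering_skew_comm[OF assms(2-4)]] assms(1) by simp
  show "skew_comm (1 / p) x' (y' - x) \<in> I"
    by (rule lowering_skew_comm) fact+
qed (use assms in simp_all)

text \<open>Removing the units from \<open>z\<close> and \<open>z'\<close> requires the parameter \<open>1/p\<close>: under the unit \<open>x'\<close> that is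
  subtracted from \<open>z\<close>, the difference \<open>z - x'\<close> has weight \<open>1/p\<close>. The Serre element is symmetric under
  \<open>p \<mapsto> 1/p\<close>, so nothing is lost.\<close>

lemma raising_serre:
  assumes "p \<noteq> 0" "x * x' - 1 \<in> I" "x' * x - 1 \<in> I"
    and "skew_comm (1 / p) z x - (1 - 1 / p) *s 1 \<in> I"
    and "skew_comm (1 / p) z' x' - (1 - 1 / p) *s 1 \<in> I"
    and "serre p z z' \<in> I"
  shows "serre p (r *s (1 - x * z)) (s *s (1 - x' * z')) \<in> I"
proof -
  define g where "g = z - x'"
  define g' where "g' = z' - x"
  have xg: "skew_comm p x g \<in> I"
    unfolding g_def by (rule shifted_raising_skew_comm) fact+
  have x'g': "skew_comm p x' g' \<in> I"
    unfolding g'_def by (rule shifted_raising_skew_comm) fact+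
  have x'g: "skew_comm (1 / p) x' g \<in> I"
    using skew_comm_inverse[OF assms(2,3) xg assms(1)] .
  have "serre (1 / p) g g' \<in> I"
    by (rule serre_remove_units[of _ x' x])
      (use assms x'g' x'g in \<open>simp_all add: g_def g'_def serre_inverse\<close>)
  then have "serre (1 / p) (g * x) (g' * x') \<in> I"
    by (intro serre_twist) (use assms x'g' x'g in simp_all)
  then have twisted: "serre p (g * x) (g' * x') \<in> I"
    using assms(1) by (simp add: serre_inverse)
  have raise: "r *s (1 - x * z) - (- r * p) *s ((z - x') * x) \<in> I"
    if "x * x' - 1 \<in> I" "skew_comm p x (z - x') \<in> I" for r x x' z
  proof -
    have "r *s (1 - x * z) - (- r * p) *s ((z - x') * x) =
        (r *s (1 - x * z) - (- r) *s (x * (z - x'))) - r *s skew_comm p x (z - x')"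
      by (simp add: skew_comm_def algebra_simps)
    then show ?thesis by (rule eq_mem) (blast intro: mem_intros raising_cong[OF that(1), of r z] that(2))
  qed
  have "serre p (r *s (1 - x * z)) (s *s (1 - x' * z'))
      - serre p ((- r * p) *s (g * x)) ((- s * p) *s (g' * x')) \<in> I"
    using raise[of x x' z r] raise[of x' x z' s] assms(2,3) xg x'g'
    by (intro serre_cong) (simp_all add: g_def g'_def)
  then show ?thesis
    by (rule mem_cong) (simp only: serre_scale, intro scale_mem twisted)
qed

end

section \<open>The universal property of a presentation\<close>

lemma ring_ring_of_type_algebra: "ring (ring_of_type_algebra :: 'a::ring_1 ring)"
proof -
  have "\<exists>y. x + y = 0" for x :: 'a
    using add.right_inverse by blast
  then show ?thesis
    unfolding ring_of_type_algebra_def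
    by unfold_locales (auto simp: algebra_simps Units_def)
qed

lemma free_ring_simps:
  "carrier free_ring = UNIV" "a \<otimes>\<^bsub>free_ring\<^esub> b = a * b" "a \<oplus>\<^bsub>free_ring\<^esub> b = a + b"
  "\<one>\<^bsub>free_ring\<^esub> = 1" "\<zero>\<^bsub>free_ring\<^esub> = 0"
  by (simp_all add: ring_of_type_algebra_def)

lemma ideal_rel_ideal: "ideal (rel_ideal R) free_ring"
  unfolding rel_ideal_def
  by (rule ring.genideal_ideal[OF ring_ring_of_type_algebra]) (simp add: free_ring_simps)

lemma relation_mem: "(l, r) \<in> R \<Longrightarrow> l - r \<in> rel_ideal R"
  unfolding rel_ideal_def
  by (rule subsetD[OF ring.genideal_self[OF ring_ring_of_type_algebra]])
    (auto simp: free_ring_simps)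

lemma poly_mapping_single_add_induct [case_names single add]:
  assumes "\<And>w c. P (Poly_Mapping.single w c)" "\<And>a b. P a \<Longrightarrow> P b \<Longrightarrow> P (a + b)"
  shows "P (a :: 'w \<Rightarrow>\<^sub>0 'c::monoid_add)"
proof (induction a rule: update_induct)
  case const
  show ?case using assms(1)[of undefined 0] by simp
next
  case (update f w c)
  have "Poly_Mapping.update w c f = f + Poly_Mapping.single w c"
    using update.hyps(1)
    by (intro poly_mapping_eqI) (auto simp: lookup_add lookup_update lookup_single in_keys_iff)
  then show ?case using update.IH assms by simp
qed

lemma sc_central: "a * sc c = sc c * a"
  by (induction a rule: poly_mapping_single_add_induct)
    (simp_all add: sc_def mult_single distrib_left distrib_right mult.commute)

lemma sc_mult: "sc (c * d) = sc c * sc d"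
  by (simp add: sc_def mult_single)

lemma sc_add: "sc (c + d) = sc c + sc d"
  by (simp add: sc_def single_add)

lemma sc_1 [simp]: "sc 1 = 1"
  by (simp add: sc_def)

lemma algebra_ideal_rel_ideal:
  fixes R :: "(('x, 'k::field) free_alg \<times> ('x, 'k) free_alg) set"
  shows "algebra_ideal (\<lambda>c a. sc c * a) (rel_ideal R)"
proof -
  interpret ideal "rel_ideal R" "free_ring :: ('x, 'k) free_alg ring" by (rule ideal_rel_ideal)
  show ?thesis
  proof
    show "a * (sc c * b) = sc c * (a * b)" for a b :: "('x, 'k) free_alg" and c
      by (metis mult.assoc sc_central)
  next
    show "0 \<in> rel_ideal R"
      using additive_subgroup.zero_closed[OF ideal.axioms(1)[OF ideal_rel_ideal[of R]]]
      by (simp add: free_ring_simps)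
  next
    show "a + b \<in> rel_ideal R" if "a \<in> rel_ideal R" "b \<in> rel_ideal R" for a b
      using additive_subgroup.a_closed[OF ideal.axioms(1)[OF ideal_rel_ideal] that] by (simp add: free_ring_simps)
  next
    show "a * b \<in> rel_ideal R" if "b \<in> rel_ideal R" for a b
      using I_l_closed[OF that, of a] by (simp add: free_ring_simps)
  next
    show "a * b \<in> rel_ideal R" if "a \<in> rel_ideal R" for a b
      using I_r_closed[OF that, of b] by (simp add: free_ring_simps)
  qed (simp_all add: sc_mult sc_add algebra_simps)
qed

lemma rel_ideal_subset:
  assumes "ideal J free_ring" "\<And>l r. (l, r) \<in> R \<Longrightarrow> l - r \<in> J"
  shows "rel_ideal R \<subseteq> J"
  unfolding rel_ideal_def
  by (rule ring.genideal_minimal[OF ring_ring_of_type_algebra assms(1)]) (use assms(2) in auto)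

definition free_lift :: "('x \<Rightarrow> ('y, 'k::field) free_alg) \<Rightarrow> ('x, 'k) free_alg \<Rightarrow> ('y, 'k) free_alg"
  where "free_lift f a =
    (\<Sum>w\<in>Poly_Mapping.keys a. sc (Poly_Mapping.lookup a w) * prod_list (map f (letters w)))"

lemma sc_0 [simp]: "sc 0 = 0"
  by (simp add: sc_def)

lemma free_lift_superset:
  assumes "finite A" "Poly_Mapping.keys a \<subseteq> A"
  shows "free_lift f a = (\<Sum>w\<in>A. sc (Poly_Mapping.lookup a w) * prod_list (map f (letters w)))"
  unfolding free_lift_def
  by (rule sum.mono_neutral_left) (use assms in \<open>auto simp: in_keys_iff\<close>)

lemma free_lift_add: "free_lift f (a + b) = free_lift f a + free_lift f b"
proof -
  have "Poly_Mapping.keys (a + b) \<subseteq> Poly_Mapping.keys a \<union> Poly_Mapping.keys b" by (rule keys_add)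
  then show ?thesis
    by (simp add: free_lift_superset[of "Poly_Mapping.keys a \<union> Poly_Mapping.keys b"] lookup_add sc_add
        distrib_right sum.distrib)
qed

lemma free_lift_diff: "free_lift f (a - b) = free_lift f a - free_lift f b"
  using free_lift_add[of f "a - b" b] by simp

lemma free_lift_single:
  "free_lift f (Poly_Mapping.single w c) = sc c * prod_list (map f (letters w))"
  by (subst free_lift_superset[of "{w}"]) (auto simp: lookup_single)

lemma free_lift_sc [simp]: "free_lift f (sc c) = sc c"
  using free_lift_single[of f 0 c] by (simp add: sc_def zero_word_def)

lemma free_lift_0 [simp]: "free_lift f 0 = 0"
  by (simp add: free_lift_def)

lemma free_lift_1 [simp]: "free_lift f 1 = 1"
  using free_lift_sc[of f 1] by simp

lemma free_lift_gen [simp]: "free_lift f (gen x) = f x"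
  by (simp add: gen_def free_lift_single)

lemma free_lift_mult: "free_lift f (a * b) = free_lift f a * free_lift f b"
proof (induction a rule: poly_mapping_single_add_induct)
  case (single v c)
  show ?case
  proof (induction b rule: poly_mapping_single_add_induct)
    case (single w d)
    show ?case
      by (simp add: mult_single free_lift_single plus_word_def sc_mult mult.assoc)
        (metis mult.assoc sc_central)
  qed (simp add: distrib_left free_lift_add)
qed (simp add: distrib_right free_lift_add)

lemma free_lift_rel_ideal:
  assumes "\<And>l r. (l, r) \<in> R \<Longrightarrow> free_lift f l - free_lift f r \<in> rel_ideal R'"
    and "a \<in> rel_ideal R"
  shows "free_lift f a \<in> rel_ideal R'"
proof -
  let ?J = "{a. free_lift f a \<in> rel_ideal R'}"
  have "free_lift f \<in> ring_hom free_ring free_ring"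
    by (rule ring_hom_memI) (simp_all add: free_ring_simps free_lift_mult free_lift_add)
  then have "ring_hom_ring free_ring free_ring (free_lift f)"
    by (intro ring_hom_ringI2 ring_ring_of_type_algebra)
  from ring_hom_ring.ideal_vimage[OF this ideal_rel_ideal[of R']]
  have "ideal ?J free_ring"
    by (simp add: free_ring_simps)
  then have "rel_ideal R \<subseteq> ?J"
    by (rule rel_ideal_subset) (simp add: free_lift_diff assms(1))
  with assms(2) show ?thesis by auto
qed

lemma cls_eq_iff: "cls R a = cls R b \<longleftrightarrow> a - b \<in> rel_ideal R"
proof -
  have mem: "c \<in> cls R d \<longleftrightarrow> c - d \<in> rel_ideal R" for c d
    by (force simp: cls_def a_r_coset_def' free_ring_simps)
  show ?thesis
  proof
    assume "cls R a = cls R b"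
    then show "a - b \<in> rel_ideal R" using mem[of a a] mem[of a b]
      by (simp add: algebra_ideal.zero_mem[OF algebra_ideal_rel_ideal])
  next
    assume ab: "a - b \<in> rel_ideal R"
    have "c - a \<in> rel_ideal R \<longleftrightarrow> c - b \<in> rel_ideal R" for c
      using algebra_ideal.add_mem[OF algebra_ideal_rel_ideal _ ab, of "c - a"] algebra_ideal.diff_mem[OF algebra_ideal_rel_ideal _ ab, of "c - b"] by auto
    then show "cls R a = cls R b" using mem by auto
  qed
qed

lemma presented_algebra_simps:
  "carrier (presented_algebra R) = range (cls R)"
  "cls R a \<otimes>\<^bsub>presented_algebra R\<^esub> cls R b = cls R (a * b)"
  "cls R a \<oplus>\<^bsub>presented_algebra R\<^esub> cls R b = cls R (a + b)"
  "\<one>\<^bsub>presented_algebra R\<^esub> = cls R 1"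
  "c \<odot>\<^bsub>presented_algebra R\<^esub> cls R a = cls R (sc c * a)"
proof -
  interpret ideal "rel_ideal R" free_ring by (rule ideal_rel_ideal)
  show "carrier (presented_algebra R) = range (cls R)"
    by (auto simp: presented_algebra_def Let_def ring.defs module.defs FactRing_def A_RCOSETS_def'
        cls_def free_ring_simps)
  show mult: "cls R a \<otimes>\<^bsub>presented_algebra R\<^esub> cls R b = cls R (a * b)" for a b
    using rcoset_mult_add[of a b]
    by (simp add: presented_algebra_def Let_def ring.defs module.defs FactRing_def cls_def free_ring_simps)
  show "cls R a \<oplus>\<^bsub>presented_algebra R\<^esub> cls R b = cls R (a + b)"
    using a_rcos_sum[of a b]
    by (simp add: presented_algebra_def Let_def ring.defs module.defs FactRing_def cls_def free_ring_simps)
  show "\<one>\<^bsub>presented_algebra R\<^esub> = cls R 1"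
    by (simp add: presented_algebra_def Let_def ring.defs module.defs FactRing_def cls_def free_ring_simps)
  show "c \<odot>\<^bsub>presented_algebra R\<^esub> cls R a = cls R (sc c * a)"
    using mult[of "sc c" a]
    by (simp add: presented_algebra_def Let_def ring.defs module.defs)
qed

text \<open>The induced map is defined on a coset through a chosen representative; the lift carries the
  ideal of relations into the target ideal, so the choice is immaterial.\<close>

theorem presented_algebra_hom_exists:
  assumes "\<And>l r. (l, r) \<in> R \<Longrightarrow> free_lift f l - free_lift f r \<in> rel_ideal R'"
  shows "\<exists>\<phi> \<in> algebra_hom (presented_algebra R) (presented_algebra R').
    \<forall>a. \<phi> (cls R a) = cls R' (free_lift f a)"
proof -
  define \<phi> where "\<phi> Y = cls R' (free_lift f (SOME a. Y = cls R a))" for Y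
  have \<phi>: "\<phi> (cls R a) = cls R' (free_lift f a)" for a
  proof -
    have "cls R a = cls R (SOME b. cls R a = cls R b)" by (rule someI[of _ a]) simp
    then have "a - (SOME b. cls R a = cls R b) \<in> rel_ideal R" by (simp only: cls_eq_iff)
    from free_lift_rel_ideal[OF assms this]
    have "cls R' (free_lift f a) = cls R' (free_lift f (SOME b. cls R a = cls R b))"
      by (simp only: cls_eq_iff free_lift_diff)
    then show ?thesis by (simp only: \<phi>_def)
  qed
  have "\<phi> \<in> algebra_hom (presented_algebra R) (presented_algebra R')"
    by (auto simp: algebra_hom_def presented_algebra_simps \<phi> free_lift_mult free_lift_add
        intro!: ring_hom_memI)
  with \<phi> show ?thesis by blast
qed

section \<open>The equitable presentation of the loop algebra\<close>

abbreviation sc_mul :: "'k::field \<Rightarrow> ('x, 'k) free_alg \<Rightarrow> ('x, 'k) free_alg"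
  where "sc_mul c a \<equiv> sc c * a"

lemma sc_mult_assoc: "sc c * (sc d * a) = sc (c * d) * a"
  by (simp add: sc_mult mult.assoc)

lemma free_skew_comm_def: "algebra_ideal.skew_comm sc_mul c a u = a * u - sc c * (u * a)"
  by (rule algebra_ideal.skew_comm_def[OF algebra_ideal_rel_ideal[of "{}"]])

text \<open>The two forms of the q-Weyl relation differ by the factor \<open>(q - q\<^sup>-\<^sup>1) / q = 1 - 1/q\<^sup>2\<close>.\<close>

lemma q_weyl_skew_comm:
  assumes "q \<noteq> 0" "q ^ 2 \<noteq> 1" "q_weyl q a b - 1 \<in> rel_ideal R"
  shows "algebra_ideal.skew_comm sc_mul (1 / q ^ 2) a b - sc (1 - 1 / q ^ 2) * 1 \<in> rel_ideal R"
proof -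
  have d: "q - inverse q \<noteq> 0"
    using assms(1,2) by (simp add: field_simps power2_eq_square)
  define k where "k = (q - inverse q) / q"
  have "k * (1 / (q - inverse q) * q) = 1" "k * (1 / (q - inverse q) * inverse q) = 1 / q ^ 2"
    "k = 1 - 1 / q ^ 2"
    using d assms(1) by (simp_all add: k_def divide_simps power2_eq_square)
  then have "sc k * (q_weyl q a b - 1) =
      algebra_ideal.skew_comm sc_mul (1 / q ^ 2) a b - sc (1 - 1 / q ^ 2) * 1"
    by (simp add: q_weyl_def free_skew_comm_def right_diff_distrib mult.assoc sc_mult_assoc)
  then show ?thesis
    using algebra_ideal.mult_left_mem[OF algebra_ideal_rel_ideal assms(3), of "sc k"] by simp
qed

lemma q_serre_eq_serre:
  assumes "q \<noteq> 0" "q ^ 2 \<noteq> 1"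
  shows "q_serre q a b = algebra_ideal.serre sc_mul (q ^ 2) a b"
proof -
  have d: "q - inverse q \<noteq> 0"
    using assms by (simp add: field_simps power2_eq_square)
  have "q ^ 3 - inverse q ^ 3 = (q ^ 2 + 1 + 1 / q ^ 2) * (q - inverse q)"
    using assms(1) by (simp add: field_simps power2_eq_square power3_eq_cube)
  then have "qint q 3 = q ^ 2 + 1 + 1 / q ^ 2"
    using d by (simp add: qint_def)
  then show ?thesis
    using assms(1)
    by (simp add: q_serre_def algebra_ideal.serre_expand[OF algebra_ideal_rel_ideal[of "{}"]]
        power3_eq_cube power2_eq_square mult.assoc)
qed

lemma cases_2: "i = 0 \<or> i = 1" for i :: 2
proof (cases i)
  case (of_int z)
  then have "z = 0 \<or> z = 1" by auto
  with of_int(1) show ?thesis by auto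
qed

lemma one_minus_index: "1 - (1 - i) = i" "1 - i \<noteq> i" "i \<noteq> j \<longleftrightarrow> j = 1 - i" for i j :: 2
  using cases_2[of i] cases_2[of j] by auto

definition equitable_image ::
  "'k::field \<Rightarrow> (2 \<Rightarrow> ('y, 'k) free_alg) \<Rightarrow> (2 \<Rightarrow> ('y, 'k) free_alg) \<Rightarrow> (2 \<Rightarrow> ('y, 'k) free_alg)
    \<Rightarrow> loop_gen \<Rightarrow> ('y, 'k) free_alg"
  where "equitable_image q x y z g = (case g of
      GK i \<Rightarrow> x i
    | GEplus i \<Rightarrow> sc (1 / (q * (q - inverse q) ^ 2)) * (1 - x i * z i)
    | GEminus i \<Rightarrow> y i - x (1 - i))"

text \<open>The direction of the universal property of the equitable presentation that produces
  homomorphisms. The index set of the generators is the ring of integers modulo 2, so \<open>1 - i\<close> is the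
  other index, and \<open>x\<^bsub>1 - i\<^esub>\<close> is the inverse of \<open>x\<^sub>i\<close>.\<close>

theorem equitable_hom_exists:
  fixes q :: "'k::field" and x y z :: "2 \<Rightarrow> ('y, 'k) free_alg"
  assumes q: "q \<noteq> 0" "q ^ 2 \<noteq> 1"
    and xx: "\<And>i. x i * x (1 - i) - 1 \<in> rel_ideal R"
    and xy: "\<And>i. q_weyl q (x i) (y i) - 1 \<in> rel_ideal R"
    and yz: "\<And>i. q_weyl q (y i) (z i) - 1 \<in> rel_ideal R"
    and zx: "\<And>i. q_weyl q (z i) (x i) - 1 \<in> rel_ideal R"
    and zy: "\<And>i. q_weyl q (z i) (y (1 - i)) - 1 \<in> rel_ideal R"
    and yy: "\<And>i. q_serre q (y i) (y (1 - i)) \<in> rel_ideal R"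
    and zz: "\<And>i. q_serre q (z i) (z (1 - i)) \<in> rel_ideal R"
  shows "\<exists>\<phi> \<in> algebra_hom (loop_algebra q) (presented_algebra R).
    \<forall>i. \<phi> (loop_x q i) = cls R (x i) \<and> \<phi> (loop_y q i) = cls R (y i) \<and> \<phi> (loop_z q i) = cls R (z i)"
proof -
  note A = algebra_ideal_rel_ideal[of R]
  define f where "f = equitable_image q x y z"
  define \<gamma> where "\<gamma> = 1 / (q * (q - inverse q) ^ 2)"
  define e where "e i = sc \<gamma> * (1 - x i * z i)" for i
  define m where "m i = y i - x (1 - i)" for i
  have d: "q - inverse q \<noteq> 0" and p: "q ^ 2 \<noteq> 0"
    using q by (auto simp: field_simps power2_eq_square)
  have lift: "free_lift f (lK i) = x i" "free_lift f (lKinv i) = x (1 - i)"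
    "free_lift f (eplus i) = e i" "free_lift f (eminus i) = m i" for i
    by (simp_all add: lK_def lKinv_def eplus_def eminus_def f_def equitable_image_def e_def m_def \<gamma>_def)
  have xx': "x (1 - i) * x i - 1 \<in> rel_ideal R" for i
    using xx[of "1 - i"] by (simp only: one_minus_index)
  note weyl = q_weyl_skew_comm[OF q xy] q_weyl_skew_comm[OF q yz] q_weyl_skew_comm[OF q zx]
    q_weyl_skew_comm[OF q zy]
  have weyl_x': "algebra_ideal.skew_comm sc_mul (1 / q ^ 2) (x (1 - i)) (y (1 - i))
      - sc (1 - 1 / q ^ 2) * 1 \<in> rel_ideal R" for i
    by (rule weyl)
  have x_e: "algebra_ideal.skew_comm sc_mul (q ^ 2) (x i) (e i) \<in> rel_ideal R" for i
    unfolding e_def by (rule algebra_ideal.raising_skew_comm[OF A p weyl(3)])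
  have x_m: "algebra_ideal.skew_comm sc_mul (1 / q ^ 2) (x i) (m i) \<in> rel_ideal R" for i
    unfolding m_def by (rule algebra_ideal.lowering_skew_comm[OF A xx xx' weyl(1)])
  have x'_e: "algebra_ideal.skew_comm sc_mul (1 / q ^ 2) (x (1 - i)) (e i) \<in> rel_ideal R" for i
    by (rule algebra_ideal.skew_comm_inverse[OF A xx xx' x_e p])
  have x'_m: "algebra_ideal.skew_comm sc_mul (q ^ 2) (x (1 - i)) (m i) \<in> rel_ideal R" for i
    using algebra_ideal.skew_comm_inverse[OF A xx xx' x_m] p by simp
  note conj = algebra_ideal.conjugate_mem[OF A xx x_e] algebra_ideal.conjugate_mem[OF A xx x_m]
    algebra_ideal.conjugate_mem[OF A xx' x'_e] algebra_ideal.conjugate_mem[OF A xx' x'_m]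
  have inv: "inverse q ^ 2 = 1 / q ^ 2"
    by (simp add: field_simps)
  have \<gamma>: "\<gamma> * (q ^ 2 - 1) = 1 / (q - inverse q)" "\<gamma> * (q * (q - inverse q) ^ 2) = 1"
  proof -
    have "q ^ 2 - 1 = q * (q - inverse q)"
      using q(1) by (simp add: field_simps power2_eq_square)
    then show "\<gamma> * (q ^ 2 - 1) = 1 / (q - inverse q)"
      using d q(1) by (simp add: \<gamma>_def power2_eq_square)
    show "\<gamma> * (q * (q - inverse q) ^ 2) = 1"
      using d q(1) by (simp add: \<gamma>_def)
  qed
  have em: "e i * m i - m i * e i - sc (1 / (q - inverse q)) * (x i - x (1 - i)) \<in> rel_ideal R" for i
    using algebra_ideal.raising_lowering_comm[OF A p xx xx' weyl(1-3), where r = \<gamma>]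
    unfolding \<gamma> e_def m_def .
  have em': "e i * m (1 - i) - m (1 - i) * e i \<in> rel_ideal R" for i
    using algebra_ideal.raising_other_lowering_comm[OF A p xx xx' weyl_x' weyl(4) weyl(3), where r = \<gamma>]
    unfolding e_def m_def one_minus_index .
  have ee: "q_serre q (e i) (e (1 - i)) \<in> rel_ideal R" for i
    unfolding q_serre_eq_serre[OF q] e_def
    by (rule algebra_ideal.raising_serre[OF A p xx xx' weyl(3) weyl(3)])
      (rule zz[unfolded q_serre_eq_serre[OF q]])
  have mm: "q_serre q (m i) (m (1 - i)) \<in> rel_ideal R" for i
    unfolding q_serre_eq_serre[OF q] m_def one_minus_index
    by (rule algebra_ideal.lowering_serre[OF A p xx xx' weyl(1) weyl(1)])
      (rule yy[unfolded q_serre_eq_serre[OF q]])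
  note lifts = lift free_lift_mult free_lift_diff free_lift_add free_lift_sc free_lift_0 free_lift_1
    inv one_minus_index diff_0_right
  have K: "free_lift f (lK 0 * lK 1) - free_lift f 1 \<in> rel_ideal R"
    "free_lift f (lK 1 * lK 0) - free_lift f 1 \<in> rel_ideal R"
    using xx[of 0] xx[of 1] by (simp_all add: lifts)
  have K_same: "free_lift f (lK i * eplus i * lKinv i) - free_lift f (sc (q ^ 2) * eplus i) \<in> rel_ideal R"
    "free_lift f (lK i * eminus i * lKinv i) - free_lift f (sc (inverse q ^ 2) * eminus i) \<in> rel_ideal R"
    for i
    using conj(1,2)[of i] by (simp_all only: lifts)
  have K_other: "free_lift f (lK i * eplus j * lKinv i) - free_lift f (sc (inverse q ^ 2) * eplus j) \<in> rel_ideal R"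
    "free_lift f (lK i * eminus j * lKinv i) - free_lift f (sc (q ^ 2) * eminus j) \<in> rel_ideal R"
    if "i \<noteq> j" for i j
    using conj(3,4)[of "1 - i"] that unfolding one_minus_index by (simp_all only: lifts)
  have comm: "free_lift f (eplus i * eminus i - eminus i * eplus i)
      - free_lift f (sc (1 / (q - inverse q)) * (lK i - lKinv i)) \<in> rel_ideal R" for i
    using em[of i] by (simp only: lifts)
  have comm_other: "free_lift f (eplus 0 * eminus 1 - eminus 1 * eplus 0) - free_lift f 0 \<in> rel_ideal R"
    "free_lift f (eminus 0 * eplus 1 - eplus 1 * eminus 0) - free_lift f 0 \<in> rel_ideal R"
    using em'[of 0] algebra_ideal.uminus_mem[OF A em'[of 1]] by (simp_all add: lifts)
  have serre: "free_lift f (q_serre q (eplus i) (eplus j)) - free_lift f 0 \<in> rel_ideal R"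
    "free_lift f (q_serre q (eminus i) (eminus j)) - free_lift f 0 \<in> rel_ideal R"
    if "i \<noteq> j" for i j
    using ee[of i] mm[of i] that unfolding one_minus_index
    by (simp_all only: lifts q_serre_def power2_eq_square power3_eq_cube)
  have "free_lift f l - free_lift f r \<in> rel_ideal R" if "(l, r) \<in> loop_rels q" for l r
    using that unfolding loop_rels_def
    by safe (rule K K_same K_other comm comm_other serre; assumption?)+
  from presented_algebra_hom_exists[OF this]
  obtain \<phi> where \<phi>: "\<phi> \<in> algebra_hom (loop_algebra q) (presented_algebra R)"
    "\<And>a. \<phi> (cls (loop_rels q) a) = cls R (free_lift f a)"
    unfolding loop_algebra_def by blast
  have \<phi>_xy: "\<phi> (loop_x q i) = cls R (x i)" "\<phi> (loop_y q i) = cls R (y i)" for i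
    by (simp_all add: \<phi>(2) loop_x_def loop_y_def lift free_lift_add m_def)
  have \<phi>_z: "\<phi> (loop_z q i) = cls R (z i)" for i
  proof -
    let ?c = "q * (q - inverse q) ^ 2"
    have x'e: "x (1 - i) * e i = sc \<gamma> * (x (1 - i) * (1 - x i * z i))"
      unfolding e_def by (rule algebra_ideal.mult_scale_right[OF A])
    have "x (1 - i) * e i * sc ?c = sc ?c * (x (1 - i) * e i)"
      by (rule sc_central)
    also have "\<dots> = x (1 - i) * (1 - x i * z i)"
      using \<gamma>(2) by (simp only: x'e sc_mult_assoc mult.commute[of ?c \<gamma>] sc_1 mult_1_left)
    finally have "x (1 - i) * e i * sc ?c = x (1 - i) * (1 - x i * z i)" .
    then have "free_lift f (lKinv i - lKinv i * eplus i * sc ?c)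
        = x (1 - i) - x (1 - i) * (1 - x i * z i)"
      by (simp only: lift free_lift_diff free_lift_mult free_lift_sc)
    also have "\<dots> - z i = (x (1 - i) * x i - 1) * z i"
      by (simp add: left_diff_distrib right_diff_distrib mult.assoc)
    finally have "free_lift f (lKinv i - lKinv i * eplus i * sc ?c) - z i \<in> rel_ideal R"
      using algebra_ideal.mult_right_mem[OF A xx', of i "z i"] by simp
    then show ?thesis
      by (simp only: \<phi>(2) loop_z_def cls_eq_iff)
  qed
  show ?thesis by (intro bexI[OF _ \<phi>(1)] allI conjI \<phi>_xy \<phi>_z)
qed

section \<open>Homomorphisms into the q-tetrahedron algebra\<close>

theorem proposition8p3:
  fixes q :: "'k::field" and i :: 4
  assumes "q \<noteq> 0" and "q ^ 2 \<noteq> 1"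
  shows "\<exists>\<phi> \<in> algebra_hom (loop_algebra q) (tet_algebra q).
    \<phi> (loop_x q 1) = tet_x q i (i + 2) \<and>
    \<phi> (loop_y q 1) = tet_x q (i + 2) (i + 3) \<and>
    \<phi> (loop_z q 1) = tet_x q (i + 3) i \<and>
    \<phi> (loop_x q 0) = tet_x q (i + 2) i \<and>
    \<phi> (loop_y q 0) = tet_x q i (i + 1) \<and>
    \<phi> (loop_z q 0) = tet_x q (i + 1) (i + 2)"
proof -
  \<comment> \<open>The index \<open>j\<close> corresponds to the base vertex \<open>s j\<close>. The equitable triple at \<open>j\<close> is read off
      the triangle \<open>s j, s j + 2, s j + 3\<close>, and exchanging the indices rotates the square by \<open>2\<close>.\<close>
  define s :: "2 \<Rightarrow> 4" where "s j = (if j = 0 then i + 2 else i)" for j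
  have s_flip: "s (1 - j) = s j + 2" for j
    using cases_2[of j] by (auto simp: s_def)
  have inverse_mem: "tet h j * tet j h - 1 \<in> rel_ideal (tet_rels q)" if "j - h = 2" for h j
    using that by (intro relation_mem) (auto simp: tet_rels_def)
  have weyl_mem: "q_weyl q (tet h j) (tet j k) - 1 \<in> rel_ideal (tet_rels q)"
    if "(j - h, k - j) \<in> {(1, 1), (1, 2), (2, 1)}" for h j k
    using that by (intro relation_mem) (auto simp: tet_rels_def)
  have serre_mem: "q_serre q (tet h j) (tet k l) \<in> rel_ideal (tet_rels q)"
    if "j - h = 1" "k - j = 1" "l - k = 1" for h j k l
    using that relation_mem[of "q_serre q (tet h j) (tet k l)" 0 "tet_rels q"]
    by (auto simp: tet_rels_def)
  have wrap: "a + 2 + 2 = a" "a + 2 + 3 = a + 1" for a :: 4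
    by (simp_all add: eq_iff_diff_eq_0[of _ a] eq_iff_diff_eq_0[of _ "a + 1"])
  have "\<exists>\<phi> \<in> algebra_hom (loop_algebra q) (presented_algebra (tet_rels q)).
    \<forall>j. \<phi> (loop_x q j) = cls (tet_rels q) (tet (s j) (s j + 2))
      \<and> \<phi> (loop_y q j) = cls (tet_rels q) (tet (s j + 2) (s j + 3))
      \<and> \<phi> (loop_z q j) = cls (tet_rels q) (tet (s j + 3) (s j))"
    by (rule equitable_hom_exists[OF assms]; (unfold s_flip wrap)?;
        rule inverse_mem weyl_mem serre_mem; simp)
  then obtain \<phi> where \<phi>: "\<phi> \<in> algebra_hom (loop_algebra q) (tet_algebra q)"
    "\<And>j. \<phi> (loop_x q j) = tet_x q (s j) (s j + 2)"
    "\<And>j. \<phi> (loop_y q j) = tet_x q (s j + 2) (s j + 3)"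
    "\<And>j. \<phi> (loop_z q j) = tet_x q (s j + 3) (s j)"
    unfolding tet_algebra_def tet_x_def by blast
  have "s 1 = i" "s 0 = i + 2" by (simp_all add: s_def)
  with \<phi>(2-4)[of 0] \<phi>(2-4)[of 1] show ?thesis
    by (intro bexI[OF _ \<phi>(1)]) (simp only: wrap)
qed

end
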